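(* Let $\sigma$ be an s-finite kernel from a measurable space $S$ to a standard Borel space $T$. Then there exists a measurable partial function $d:S\times\mathbb{N}\times[0,1]\rightharpoonup T$ such that, for all $s\in S$, $$\sigma(s)=d(s,-)_*\big(\#_{\mathbb{N}}\otimes\mathbb{U}_{[0,1]}\big).$$ Conversely, any kernel from $S$ to $T$ obtained in this way from a measurable partial function $d:S\times\mathbb{N}\times[0,1]\rightharpoonup T$ is s-finite.
   Context: A kernel from a measurable space $S$ to a measurable space $T$ is a map $\sigma:S\times\Sigma_T\to[0,\infty]$ that is measurable in its first argument and a measure in its second; $\sigma(s)$ denotes the measure $\sigma(s,-)$. It is finite if $\sup_{s}\sigma(s,T)<\infty$, and s-finite if it is a countable sum of finite kernels from $S$ to $T$. A measurable partial function $X\rightharpoonup Y$ is a measurable function $X\to Y+\{\bot\}$ (undefined where the value is $\bot$). The pushforward of a measure $m$ on $X$ along a measurable partial function $h:X\rightharpoonup Y$ is $(h_*m)(U)=m(\{x\mid h(x)\in U\})$ for $U\in\Sigma_Y$ (mass sent to $\bot$ is discarded). $\#_{\mathbb{N}}$ is the counting measure on $\mathbb{N}$ (discrete $\sigma$-algebra), $\mathbb{U}_{[0,1]}$ is the uniform (Lebesgue) measure on $[0,1]$, and $\otimes$ is the product measure. A standard Borel space is a set with the Borel $\sigma$-algebra of some complete separable metric. *)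

theory Defs
  imports "HOL-Analysis.Analysis"
begin

definition standard_borel_space :: "'t measure \<Rightarrow> bool" where
  "standard_borel_space T \<longleftrightarrow>
     (\<exists>m :: 't metric. mspace m = space T \<and> mcomplete_of m \<and>
        separable_space (mtopology_of m) \<and>
        sets T = sigma_sets (space T) {U. openin (mtopology_of m) U})"

definition measure_kernel :: "'s measure \<Rightarrow> 't measure \<Rightarrow> ('s \<Rightarrow> 't measure) \<Rightarrow> bool" where
  "measure_kernel S T \<sigma> \<longleftrightarrow>
     (\<forall>s\<in>space S. sets (\<sigma> s) = sets T) \<and>
     (\<forall>B\<in>sets T. (\<lambda>s. emeasure (\<sigma> s) B) \<in> borel_measurable S)"

definition finite_kernel :: "'s measure \<Rightarrow> 't measure \<Rightarrow> ('s \<Rightarrow> 't measure) \<Rightarrow> bool" where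
  "finite_kernel S T \<sigma> \<longleftrightarrow>
     measure_kernel S T \<sigma> \<and> (SUP s\<in>space S. emeasure (\<sigma> s) (space T)) < \<infinity>"

text \<open>Finite sums are covered because the zero kernel is finite.\<close>

definition s_finite_kernel :: "'s measure \<Rightarrow> 't measure \<Rightarrow> ('s \<Rightarrow> 't measure) \<Rightarrow> bool" where
  "s_finite_kernel S T \<sigma> \<longleftrightarrow>
     measure_kernel S T \<sigma> \<and>
     (\<exists>\<tau> :: nat \<Rightarrow> 's \<Rightarrow> 't measure. (\<forall>i. finite_kernel S T (\<tau> i)) \<and>
        (\<forall>s\<in>space S. \<forall>B\<in>sets T. emeasure (\<sigma> s) B = (\<Sum>i. emeasure (\<tau> i s) B)))"

text \<open>The disjoint sum of \<open>Y\<close> and a one-point space, with \<^const>\<open>None\<close> as the extra point.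
  As for \<^const>\<open>sigma\<close>, only the underlying measurable space matters.\<close>

definition option_space :: "'b measure \<Rightarrow> 'b option measure" where
  "option_space Y = sigma (insert None (Some ` space Y))
     {A. A \<subseteq> insert None (Some ` space Y) \<and> Some -` A \<in> sets Y}"

lemma space_option_space [simp]: "space (option_space Y) = insert None (Some ` space Y)"
  unfolding option_space_def by (rule space_measure_of) auto

lemma sets_option_space:
  "sets (option_space Y) = {A. A \<subseteq> insert None (Some ` space Y) \<and> Some -` A \<in> sets Y}"
proof -
  let ?\<Omega> = "insert None (Some ` space Y)"
  let ?M = "{A. A \<subseteq> ?\<Omega> \<and> Some -` A \<in> sets Y}"
  have 1: "Some -` (?\<Omega> - A) = space Y - Some -` A" for A
    by auto
  have "sigma_algebra ?\<Omega> ?M"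
    unfolding sigma_algebra_iff2 by (auto simp: 1 vimage_UN)
  then show ?thesis
    unfolding option_space_def by (simp add: sigma_algebra.sets_measure_of_eq)
qed

abbreviation partial_measurable :: "'a measure \<Rightarrow> 'b measure \<Rightarrow> ('a \<Rightarrow> 'b option) set" where
  "partial_measurable X Y \<equiv> X \<rightarrow>\<^sub>M option_space Y"

definition partial_distr :: "'a measure \<Rightarrow> 'b measure \<Rightarrow> ('a \<Rightarrow> 'b option) \<Rightarrow> 'b measure" where
  "partial_distr m Y h =
     measure_of (space Y) (sets Y) (\<lambda>U. emeasure m {x \<in> space m. h x \<in> Some ` U})"

lemma space_partial_distr [simp]: "space (partial_distr m Y h) = space Y"
  by (simp add: partial_distr_def)

lemma sets_partial_distr [simp]: "sets (partial_distr m Y h) = sets Y"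
  by (simp add: partial_distr_def)

lemma emeasure_partial_distr:
  assumes h: "h \<in> partial_measurable m Y" and U: "U \<in> sets Y"
  shows "emeasure (partial_distr m Y h) U = emeasure m {x \<in> space m. h x \<in> Some ` U}"
proof (rule emeasure_measure_of[OF partial_distr_def])
  let ?\<mu> = "\<lambda>U. emeasure m {x \<in> space m. h x \<in> Some ` U}"
  have meas: "{x \<in> space m. h x \<in> Some ` V} \<in> sets m" if "V \<in> sets Y" for V
  proof -
    have "Some ` V \<in> sets (option_space Y)"
      using that sets.sets_into_space[OF that] by (auto simp: sets_option_space inj_vimage_image_eq)
    from measurable_sets[OF h this] show ?thesis
      by (simp add: vimage_def Int_def conj_commute)
  qed
  show "countably_additive (sets (partial_distr m Y h)) ?\<mu>"
  proof (rule countably_additiveI)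
    fix A :: "nat \<Rightarrow> 'b set"
    assume A: "range A \<subseteq> sets (partial_distr m Y h)" and d: "disjoint_family A"
    let ?B = "\<lambda>i. {x \<in> space m. h x \<in> Some ` A i}"
    have "(\<Sum>i. emeasure m (?B i)) = emeasure m (\<Union>i. ?B i)"
    proof (rule suminf_emeasure)
      show "range ?B \<subseteq> sets m"
        using A by (auto intro!: meas)
      show "disjoint_family ?B"
        using d by (fastforce simp: disjoint_family_on_def)
    qed
    also have "(\<Union>i. ?B i) = {x \<in> space m. h x \<in> Some ` (\<Union>i. A i)}"
      by auto
    finally show "(\<Sum>i. ?\<mu> (A i)) = ?\<mu> (\<Union>i. A i)" .
  qed
qed (use U sets.space_closed in \<open>auto simp: positive_def\<close>)

abbreviation counting_nat :: "nat measure" where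
  "counting_nat \<equiv> count_space UNIV"

abbreviation uniform01 :: "real measure" where
  "uniform01 \<equiv> restrict_space lborel {0..1}"

end

theory Submission
  imports Defs "HOL-Probability.Weak_Convergence"
begin

text \<open>A finite kernel is a multiple of a subprobability kernel, so an s-finite kernel is a countable
  sum of subprobability kernels; the \<open>\<nat>\<close>-component indexes the summands and the
  \<open>[0,1]\<close>-component randomizes each of them. For kernels to the reals the randomization is the
  quantile function of the conditional distribution function, left undefined beyond the total mass;
  its joint measurability comes from \<open>quantile s u \<le> x \<longleftrightarrow> u \<le> F s x\<close>. A standard Borel space is a
  measurable retract of the reals, by a partial retraction, which carries the randomization over.
  Conversely, the slices of \<open>d\<close> at each natural number push the uniform measure to subprobability kernels.\<close>

subsection \<open>Measurable partial functions\<close>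

lemma Some_measurable: "Some \<in> Y \<rightarrow>\<^sub>M option_space Y"
  by (rule measurableI) (auto simp: sets_option_space Int_absorb2 sets.sets_into_space)

text \<open>\<open>f\<close> only has to be measurable where \<open>P\<close> holds, so an infimum
  or a choice that is meaningless elsewhere can still serve as \<open>f\<close>.\<close>

lemma partial_measurable_If:
  assumes P: "{x \<in> space X. P x} \<in> sets X"
    and f: "f \<in> restrict_space X {x. P x} \<rightarrow>\<^sub>M Y"
  shows "(\<lambda>x. if P x then Some (f x) else None) \<in> partial_measurable X Y"
proof (subst measurable_If_restrict_space_iff[OF P], intro conjI)
  show "(\<lambda>x. Some (f x)) \<in> restrict_space X {x. P x} \<rightarrow>\<^sub>M option_space Y"
    by (rule measurable_compose[OF f Some_measurable])
qed simp

text \<open>Makes composition of partial maps an ordinary composition: the second map is extended to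
  \<open>option_space X\<close> by sending \<open>None\<close> to \<open>None\<close>.\<close>

lemma measurable_bind_partial:
  assumes p: "p \<in> partial_measurable X Y"
  shows "(\<lambda>z. Option.bind z p) \<in> option_space X \<rightarrow>\<^sub>M option_space Y"
proof (rule measurableI)
  show "Option.bind z p \<in> space (option_space Y)" if "z \<in> space (option_space X)" for z
    using that measurable_space[OF p] by (cases z) (auto split: option.splits)
next
  fix A assume "A \<in> sets (option_space Y)"
  moreover have "Some -` ((\<lambda>z. Option.bind z p) -` A \<inter> insert None (Some ` space X)) = p -` A \<inter> space X"
    by auto
  ultimately show "(\<lambda>z. Option.bind z p) -` A \<inter> space (option_space X) \<in> sets (option_space X)"
    using measurable_sets[OF p] by (simp add: sets_option_space[of X])
qed

lemma partial_measurable_vimage: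
  assumes "h \<in> partial_measurable X Y" "B \<in> sets Y"
  shows "{x \<in> space X. h x \<in> Some ` B} \<in> sets X"
proof -
  have "Some ` B \<in> sets (option_space Y)"
    using assms(2) sets.sets_into_space[OF assms(2)] by (auto simp: sets_option_space inj_vimage_image_eq)
  from measurable_sets[OF assms(1) this] show ?thesis
    by (simp add: vimage_def Int_def conj_commute)
qed

subsection \<open>Coding a standard Borel space by real numbers\<close>

text \<open>Scaling by \<open>3 ^ n\<close> turns the terms before \<open>n\<close> into multiples
  of 3, term \<open>n\<close> into the digit itself, and the rest into a tail of at most 1/2, which
  the floor discards. In base 2 the tail could reach 1 and spoil the digit.\<close>

lemma ternary_digit:
  fixes b :: "nat \<Rightarrow> bool"
  shows "\<lfloor>3 ^ n * (\<Sum>k. of_bool (b k) / 3 ^ k :: real)\<rfloor> mod 3 = of_bool (b n)"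
proof -
  let ?f = "\<lambda>k. of_bool (b k) / 3 ^ k :: real"
  have f: "0 \<le> ?f k" "?f k \<le> (1 / 3) ^ k" for k
    by (auto simp: power_divide)
  have summ: "summable ?f"
    by (rule summable_comparison_test[OF _ summable_geometric[of "1/3"]]) (use f in auto)
  define A :: int where "A = (\<Sum>k<n. of_bool (b k) * 3 ^ (n - k))"
  have A: "3 ^ n * (\<Sum>k<n. ?f k) = of_int A"
    unfolding A_def sum_distrib_left of_int_sum of_int_mult of_int_power of_int_of_bool of_int_numeral
    by (intro sum.cong) (auto simp: power_diff)
  have "3 dvd A"
    unfolding A_def by (auto intro!: dvd_sum)
  define R where "R = 3 ^ n * (\<Sum>k. ?f (k + Suc n))"
  have summ': "summable (\<lambda>k. ?f (k + Suc n))"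
    by (rule summable_ignore_initial_segment[OF summ])
  have "R = (\<Sum>k. 3 ^ n * ?f (k + Suc n))"
    unfolding R_def by (rule suminf_mult[OF summ', symmetric])
  also have "\<dots> \<le> (\<Sum>k. (1/3) * (1 / 3) ^ k)"
    by (intro suminf_le summable_mult summ' summable_geometric) (auto simp: power_divide power_add)
  also have "\<dots> = 1 / 2"
    by (subst suminf_mult) (simp_all add: suminf_geometric summable_geometric)
  finally have "R < 1" by simp
  have "0 \<le> R"
    unfolding R_def by (intro mult_nonneg_nonneg suminf_nonneg summ') (use f in auto)
  have "(\<Sum>k. ?f k) = (\<Sum>k. ?f (k + Suc n)) + (\<Sum>k<Suc n. ?f k)"
    by (rule suminf_split_initial_segment[OF summ])
  then have "3 ^ n * (\<Sum>k. ?f k) = R + of_int (A + of_bool (b n))"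
    using A by (simp add: R_def algebra_simps)
  then have "\<lfloor>3 ^ n * (\<Sum>k. ?f k)\<rfloor> = A + of_bool (b n)"
    using \<open>0 \<le> R\<close> \<open>R < 1\<close> by (intro floor_unique) simp_all
  then show ?thesis
    using \<open>3 dvd A\<close> by (auto elim!: dvdE)
qed

text \<open>One real number stores countably many membership bits as ternary digits. Each digit is a
  Borel function on all of the reals, so \<open>B n\<close> is Borel whatever the range of
  \<open>f\<close> is.\<close>

lemma real_code_of_sets:
  fixes U :: "nat \<Rightarrow> 't set"
  assumes U: "\<And>n. U n \<in> sets T"
  obtains f :: "'t \<Rightarrow> real" and B :: "nat \<Rightarrow> real set"
  where "f \<in> borel_measurable T" "\<And>n. B n \<in> sets borel" "\<And>n t. f t \<in> B n \<longleftrightarrow> t \<in> U n"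
proof
  note U [measurable]
  show "(\<lambda>t. \<Sum>k. of_bool (t \<in> U k) / 3 ^ k :: real) \<in> borel_measurable T"
    by measurable
  show "{x :: real. \<lfloor>3 ^ n * x\<rfloor> mod 3 = 1} \<in> sets borel" for n
    by measurable
  show "(\<Sum>k. of_bool (t \<in> U k) / 3 ^ k) \<in> {x :: real. \<lfloor>3 ^ n * x\<rfloor> mod 3 = 1} \<longleftrightarrow> t \<in> U n" for n t
    unfolding mem_Collect_eq ternary_digit by simp
qed

section \<open>Fast approximation of points in a metric space\<close>

context Metric_space
begin

text \<open>The hypothesis makes \<open>y\<close> Cauchy. The rate of convergence comes from letting
  \<open>n\<close> tend to infinity in the triangle inequality through \<open>y n\<close>, with
  \<open>e\<close> as slack.\<close>

lemma mcomplete_fast_limit: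
  assumes "mcomplete" "\<And>m. y m \<in> M"
    and le: "\<And>m n. d (y m) (y n) \<le> (1/2) ^ m + (1/2) ^ n"
  shows "\<exists>t\<in>M. \<forall>m. d (y m) t \<le> (1/2) ^ m"
proof -
  have ex: "\<exists>N. \<forall>n\<ge>N. (1/2) ^ n < (\<epsilon> :: real)" if "\<epsilon> > 0" for \<epsilon>
    using order_tendstoD(2)[OF LIMSEQ_power_zero[of "1/2 :: real"] that] by (simp add: eventually_sequentially)
  have "MCauchy y"
    unfolding MCauchy_def
  proof (intro conjI allI impI)
    fix \<epsilon> :: real assume "\<epsilon> > 0"
    then obtain N where N: "\<And>n. n \<ge> N \<Longrightarrow> (1/2) ^ n < \<epsilon> / 2"
      using ex[of "\<epsilon> / 2"] by auto
    have "d (y n) (y n') < \<epsilon>" if "N \<le> n" "N \<le> n'" for n n'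
      using le[of n n'] N[OF that(1)] N[OF that(2)] by linarith
    then show "\<exists>N. \<forall>n n'. N \<le> n \<longrightarrow> N \<le> n' \<longrightarrow> d (y n) (y n') < \<epsilon>"
      by blast
  qed (use assms in auto)
  with \<open>mcomplete\<close> obtain t where "limitin mtopology y t sequentially"
    by (auto simp: mcomplete_def)
  then have t: "t \<in> M" and lim: "\<And>\<epsilon>. \<epsilon> > 0 \<Longrightarrow> \<exists>N. \<forall>n\<ge>N. d (y n) t < \<epsilon>"
    unfolding limit_metric_sequentially by blast+
  have "d (y m) t \<le> (1/2) ^ m" for m
  proof (rule field_le_epsilon)
    fix e :: real assume "e > 0"
    then obtain N1 N2 where N: "\<And>n. n \<ge> N1 \<Longrightarrow> d (y n) t < e / 2" "\<And>n. n \<ge> N2 \<Longrightarrow> (1/2) ^ n < e / 2"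
      using lim[of "e / 2"] ex[of "e / 2"] by auto
    let ?n = "max N1 N2"
    have "d (y m) t \<le> d (y m) (y ?n) + d (y ?n) t"
      using assms(2) t by (intro triangle) auto
    also have "\<dots> \<le> ((1/2) ^ m + (1/2) ^ ?n) + d (y ?n) t"
      using le by simp
    finally show "d (y m) t \<le> (1/2) ^ m + e"
      using N(1)[of ?n] N(2)[of ?n] by simp
  qed
  with t show ?thesis by blast
qed

text \<open>The distance of the two points is at most \<open>2 * (1/2) ^ m\<close> for every
  \<open>m\<close>. This is what makes decoding return the very point that was coded.\<close>

lemma eq_of_fast_approximation:
  assumes "t \<in> M" "t' \<in> M" "\<And>m. y m \<in> M" "\<And>m. d (y m) t \<le> (1/2) ^ m" "\<And>m. d (y m) t' \<le> (1/2) ^ m"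
  shows "t = t'"
proof -
  have "d t t' \<le> 2 * (1/2) ^ m" for m
    using triangle[of t "y m" t'] assms commute[of t "y m"] by (smt (verit))
  moreover have "(\<lambda>m. 2 * (1/2 :: real) ^ m) \<longlonglongrightarrow> 2 * 0"
    by (intro tendsto_intros LIMSEQ_power_zero) simp
  ultimately have "d t t' \<le> 0"
    by (metis LIMSEQ_le_const mult_zero_right)
  with assms show ?thesis
    by (metis nonneg order_antisym zero)
qed

text \<open>Expresses membership of the limit in an open set by countably many conditions on the
  approximants alone, which will give measurability of the limit map.\<close>

lemma openin_iff_mcball_fast_approximation:
  assumes "openin mtopology U" "t \<in> M" "\<And>m. y m \<in> M" "\<And>m. d (y m) t \<le> (1/2) ^ m"
  shows "t \<in> U \<longleftrightarrow> (\<exists>m. mcball (y m) ((1/2) ^ m) \<subseteq> U)"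
proof
  assume "t \<in> U"
  with assms(1) obtain r where r: "r > 0" "mball t r \<subseteq> U"
    by (auto simp: openin_mtopology)
  obtain m where m: "(1/2 :: real) ^ m < r / 2"
    using real_arch_pow_inv[of "r / 2" "1/2"] r by auto
  have "mcball (y m) ((1/2) ^ m) \<subseteq> mball t r"
  proof
    fix z assume z: "z \<in> mcball (y m) ((1/2) ^ m)"
    then have "d t z \<le> d t (y m) + d (y m) z"
      using assms by (intro triangle) auto
    with z m assms(4)[of m] commute[of t "y m"] show "z \<in> mball t r"
      using \<open>t \<in> M\<close> by auto
  qed
  with r show "\<exists>m. mcball (y m) ((1/2) ^ m) \<subseteq> U" by blast
next
  assume "\<exists>m. mcball (y m) ((1/2) ^ m) \<subseteq> U"
  with assms show "t \<in> U" by (meson in_mcball subsetD)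
qed

end

text \<open>A point is coded by its membership in the balls of radius \<open>2\<^sup>-\<^sup>m\<close> around a dense sequence;
  decoding chooses for each \<open>m\<close> the first such ball and takes the limit of the centres.
  This avoids showing that the set of codes is Borel.\<close>

lemma standard_borel_real_retract:
  assumes "standard_borel_space T"
  obtains f :: "'t \<Rightarrow> real" and p
  where "f \<in> borel_measurable T" "p \<in> partial_measurable borel T"
    "\<And>t. t \<in> space T \<Longrightarrow> p (f t) = Some t"
proof (cases "space T = {}")
  case True
  show ?thesis
    by (rule that[of "\<lambda>_. 0" "\<lambda>_. None"]) (use True in auto)
next
  case False
  from assms obtain \<mu> :: "'t metric" where \<mu>: "mspace \<mu> = space T" "mcomplete_of \<mu>"
    "separable_space (mtopology_of \<mu>)" "sets T = sigma_sets (space T) {U. openin (mtopology_of \<mu>) U}"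
    unfolding standard_borel_space_def by blast
  define d where "d = mdist \<mu>"
  interpret Metric_space "space T" d
    unfolding d_def \<mu>(1)[symmetric] by blast
  have compl: "mcomplete" and sep: "separable_space mtopology"
    and sets_T: "sets T = sigma_sets (space T) {U. openin mtopology U}"
    using \<mu> by (simp_all add: mcomplete_of_def mtopology_of_def d_def)
  from sep obtain C where C: "countable C" "C \<subseteq> space T" "mtopology closure_of C = space T"
    by (auto simp: separable_space_def)
  with False have "C \<noteq> {}" by auto
  define q where "q = from_nat_into C"
  have range_q: "range q = C"
    using C \<open>C \<noteq> {}\<close> by (simp add: q_def)
  then have q [simp]: "q k \<in> space T" for k
    using C by auto
  have dense: "\<exists>k. d (q k) t < r" if "t \<in> space T" "r > 0" for t r
  proof -
    from that C(3) have "\<exists>c\<in>C. c \<in> mball t r"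
      by (auto simp: metric_closure_of)
    then show ?thesis
      using range_q by (auto simp: commute)
  qed
  have mball_sets: "mball x r \<in> sets T" for x r
    unfolding sets_T by (rule sigma_sets.Basic) simp
  obtain f :: "'t \<Rightarrow> real" and B where f: "f \<in> borel_measurable T"
    and B: "\<And>n. B n \<in> sets borel"
    and fB: "\<And>n t. f t \<in> B n \<longleftrightarrow> t \<in> (case prod_decode n of (k, m) \<Rightarrow> mball (q k) ((1/2) ^ m))"
    by (rule real_code_of_sets[of "\<lambda>n. case prod_decode n of (k, m) \<Rightarrow> mball (q k) ((1/2) ^ m)" T])
       (auto split: prod.splits intro: mball_sets)
  \<comment> \<open>\<open>prod_decode\<close> enumerates centres and radii together. The test makes
    sense for every real \<open>x\<close>, also for one that codes no point.\<close>
  define P where "P m x k \<longleftrightarrow> x \<in> B (prod_encode (k, m))" for m x k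
  have P_f: "P m (f t) k \<longleftrightarrow> t \<in> space T \<and> d (q k) t < (1/2) ^ m" for m t k
    by (auto simp: P_def fB)
  note B [measurable]
  have [measurable]: "Measurable.pred borel (\<lambda>x. P m x k)" for m k
    unfolding P_def by measurable
  \<comment> \<open>If no \<open>k\<close> passes the test, the value is arbitrary but still
    measurable in \<open>x\<close>. For the code of a point, density supplies a
    \<open>k\<close>.\<close>
  define \<kappa> where "\<kappa> m x = (LEAST k. P m x k)" for m x
  have [measurable]: "\<kappa> m \<in> borel \<rightarrow>\<^sub>M count_space UNIV" for m
    unfolding \<kappa>_def by measurable
  define y where "y x m = q (\<kappa> m x)" for x m
  have y [simp]: "y x m \<in> space T" for x m
    by (simp add: y_def)
  \<comment> \<open>The triangle inequality forces this for codes of points, and completeness makes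
    it sufficient for the centres to converge. Reals that code no point may also be
    \<open>good\<close>.\<close>
  define good where "good x \<longleftrightarrow> (\<forall>m n. d (y x m) (y x n) \<le> (1/2) ^ m + (1/2) ^ n)" for x
  \<comment> \<open>The indices range over a countable discrete set, so \<open>Q\<close> may be any
    predicate, for instance one about distances or inclusions of balls.\<close>
  have pred_\<kappa>: "Measurable.pred borel (\<lambda>x. Q (\<kappa> m x) (\<kappa> n x))" for Q :: "nat \<Rightarrow> nat \<Rightarrow> bool" and m n
  proof (rule measurable_compose_countable'[where g = "\<kappa> m" and I = UNIV])
    show "Measurable.pred borel (\<lambda>x. Q k (\<kappa> n x))" for k
      by (rule measurable_compose[where N = "count_space UNIV" and f = "\<kappa> n"]) measurable
  qed simp_all
  have "Measurable.pred borel good"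
    unfolding good_def y_def
  proof (intro pred_intros_countable)
    show "Measurable.pred borel (\<lambda>x. d (q (\<kappa> m x)) (q (\<kappa> n x)) \<le> (1/2) ^ m + (1/2) ^ n)" for m n
      by (rule pred_\<kappa>[of "\<lambda>k l. d (q k) (q l) \<le> (1/2) ^ m + (1/2) ^ n"])
  qed
  then have good_sets: "{x \<in> space borel. good x} \<in> sets borel"
    by (rule predE)
  \<comment> \<open>Meaningful only where \<open>good x\<close> holds; there such a point exists
    and, by \<open>eq_of_fast_approximation\<close>, is unique.\<close>
  define l where "l x = (SOME t. t \<in> space T \<and> (\<forall>m. d (y x m) t \<le> (1/2) ^ m))" for x
  have l: "l x \<in> space T \<and> (\<forall>m. d (y x m) (l x) \<le> (1/2) ^ m)" if "good x" for x
  proof -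
    have "\<exists>t. t \<in> space T \<and> (\<forall>m. d (y x m) t \<le> (1/2) ^ m)"
      using mcomplete_fast_limit[OF compl, of "y x"] that unfolding good_def Bex_def by simp
    then show ?thesis
      unfolding l_def by (rule someI_ex)
  qed
  have "l \<in> restrict_space borel {x. good x} \<rightarrow>\<^sub>M T"
  proof (rule measurable_sigma_sets[OF sets_T])
    fix U assume "U \<in> {U. openin mtopology U}"
    then have "l x \<in> U \<longleftrightarrow> (\<exists>m. mcball (y x m) ((1/2) ^ m) \<subseteq> U)" if "good x" for x
      using openin_iff_mcball_fast_approximation[of U "l x" "y x"] l[OF that] by simp
    then have "l -` U \<inter> space (restrict_space borel {x. good x}) =
        (\<Union>m. {x. mcball (y x m) ((1/2) ^ m) \<subseteq> U}) \<inter> {x. good x}"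
      by (auto simp: space_restrict_space)
    also have "\<dots> \<in> sets (restrict_space borel {x. good x})"
    proof -
      have "{x. mcball (y x m) ((1/2) ^ m) \<subseteq> U} \<in> sets borel" for m
        using predE[OF pred_\<kappa>[of "\<lambda>k _. mcball (q k) ((1/2) ^ m) \<subseteq> U" m m]] by (simp add: y_def)
      then have "(\<Union>m. {x. mcball (y x m) ((1/2) ^ m) \<subseteq> U}) \<in> sets borel"
        by blast
      then show ?thesis
        by (auto simp: sets_restrict_space)
    qed
    finally show "l -` U \<inter> space (restrict_space borel {x. good x}) \<in> sets (restrict_space borel {x. good x})" .
  qed (use l openin_subset[of mtopology] in \<open>auto simp: space_restrict_space\<close>)
  then have p: "(\<lambda>x. if good x then Some (l x) else None) \<in> partial_measurable borel T"
    by (rule partial_measurable_If[OF good_sets])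
  have "(if good (f t) then Some (l (f t)) else None) = Some t" if t: "t \<in> space T" for t
  proof -
    have near: "d (y (f t) m) t \<le> (1/2) ^ m" for m
    proof -
      have "P m (f t) (\<kappa> m (f t))"
        unfolding \<kappa>_def by (rule LeastI_ex) (use dense t in \<open>simp add: P_f\<close>)
      then show ?thesis
        by (simp add: P_f y_def)
    qed
    have "good (f t)"
      unfolding good_def
    proof (intro allI)
      fix m n
      have "d (y (f t) m) (y (f t) n) \<le> d (y (f t) m) t + d t (y (f t) n)"
        using t by (intro triangle) auto
      then show "d (y (f t) m) (y (f t) n) \<le> (1/2) ^ m + (1/2) ^ n"
        using near[of m] near[of n] by (simp add: commute)
    qed
    moreover from l[OF this] have "l (f t) = t"
      using t near by (intro eq_of_fast_approximation[of _ _ "y (f t)"]) auto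
    ultimately show ?thesis by simp
  qed
  with f p show ?thesis by (rule that)
qed

subsection \<open>Randomization of kernels\<close>

lemma uniform01_simps [simp]:
  "space uniform01 = {0..1}" "sets uniform01 = sets (restrict_space borel {0..1})"
  by (auto simp: space_restrict_space sets_restrict_space)

lemma sigma_finite_uniform01: "sigma_finite_measure uniform01"
  by (intro finite_measure.axioms(1) finite_measureI) (simp add: emeasure_restrict_space)

lemma real_kernel_randomization:
  fixes K :: "'s \<Rightarrow> real measure"
  assumes K: "measure_kernel S borel K"
    and le_1: "\<And>s. s \<in> space S \<Longrightarrow> emeasure (K s) UNIV \<le> 1"
  obtains g where "g \<in> partial_measurable (S \<Otimes>\<^sub>M uniform01) borel"
    "\<And>s. s \<in> space S \<Longrightarrow> K s = partial_distr uniform01 borel (\<lambda>u. g (s, u))"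
proof -
  have sets_K: "sets (K s) = sets borel" if "s \<in> space S" for s
    using K that by (auto simp: measure_kernel_def)
  have space_K: "space (K s) = UNIV" if "s \<in> space S" for s
    using sets_eq_imp_space_eq[OF sets_K[OF that]] by simp
  have fin: "finite_borel_measure (K s)" if "s \<in> space S" for s
  proof -
    have "emeasure (K s) UNIV < \<infinity>"
      using le_1[OF that] by (rule le_less_trans) simp
    then show ?thesis
      using sets_K[OF that] space_K[OF that]
      by (auto simp: finite_borel_measure_def finite_borel_measure_axioms_def intro!: finite_measureI)
  qed
  have [measurable]: "(\<lambda>s. measure (K s) B) \<in> borel_measurable S" if "B \<in> sets borel" for B
    unfolding measure_def using K that by (auto simp: measure_kernel_def)
  define F where "F s x = cdf (K s) x" for s x
  define m where "m s = measure (K s) UNIV" for s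
  have F_bounds: "0 \<le> F s x" "F s x \<le> m s" if "s \<in> space S" for s x
    using finite_borel_measure.cdf_nonneg[OF fin[OF that]] finite_borel_measure.cdf_bounded[OF fin[OF that]]
    by (simp_all add: F_def m_def space_K[OF that])
  have m_le_1: "m s \<le> 1" if "s \<in> space S" for s
    unfolding m_def measure_def using enn2real_mono[OF le_1[OF that]] by simp
  have [measurable]: "(\<lambda>s. F s x) \<in> borel_measurable S" "m \<in> borel_measurable S" for x
    unfolding F_def m_def cdf_def by measurable
  \<comment> \<open>\<open>F s\<close> tends to 0 and to \<open>m s\<close> at the two ends, so for
    these \<open>u\<close> the set is nonempty and bounded below; right-continuity puts the infimum
    into it.\<close>
  have quantile: "Inf {x. u \<le> F s x} \<le> x \<longleftrightarrow> u \<le> F s x"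
    if s: "s \<in> space S" and u: "0 < u" "u < m s" for s u x
  proof -
    interpret finite_borel_measure "K s" by (rule fin[OF s])
    interpret right_continuous_mono "cdf (K s)" 0 "measure (K s) (space (K s))"
      by (rule right_continuous_mono.intro)
        (rule cdf_is_right_cont monoI cdf_nondecreasing cdf_lim_at_bot cdf_lim_at_top, assumption?)+
    show ?thesis
      using pseudoinverse[of u x] u unfolding F_def m_def space_K[OF s] by simp
  qed
  let ?X = "S \<Otimes>\<^sub>M uniform01"
  \<comment> \<open>Both endpoints are left out: at 0 the set below the infimum is all of the reals,
    and at \<open>m s\<close> it may be empty.\<close>
  let ?P = "\<lambda>w. 0 < snd w \<and> snd w < m (fst w)"
  let ?q = "\<lambda>w. Inf {x. snd w \<le> F (fst w) x}"
  have [measurable]: "(\<lambda>u. u) \<in> borel_measurable uniform01"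
    by (rule measurable_restrict_space1) simp
  have [measurable]: "snd \<in> borel_measurable ?X"
    by (rule measurable_compose[OF measurable_snd]) measurable
  define g where "g w = (if ?P w then Some (?q w) else None)" for w
  have P: "{w \<in> space ?X. ?P w} \<in> sets ?X"
    by measurable
  have P': "{w. ?P w} \<inter> space ?X \<in> sets ?X"
    using P by (rule back_subst[where P = "\<lambda>A. A \<in> sets ?X"]) blast
  \<comment> \<open>By \<open>quantile\<close>, a sublevel set of \<open>?q\<close> compares
    \<open>snd w\<close> with \<open>F (fst w) a\<close> for a fixed \<open>a\<close>, so
    measurability of \<open>F\<close> in \<open>s\<close> alone suffices.\<close>
  have "?q \<in> borel_measurable (restrict_space ?X {w. ?P w})"
    unfolding borel_measurable_iff_le
  proof
    fix a
    have "{w \<in> space ?X. ?P w \<and> snd w \<le> F (fst w) a} \<in> sets ?X"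
      by measurable
    then have "{w \<in> space ?X. ?P w \<and> snd w \<le> F (fst w) a} \<in> sets (restrict_space ?X {w. ?P w})"
      by (subst sets_restrict_space_iff[OF P']) blast
    moreover have "{w \<in> space (restrict_space ?X {w. ?P w}). ?q w \<le> a} =
        {w \<in> space ?X. ?P w \<and> snd w \<le> F (fst w) a}"
      using quantile by (auto simp: space_restrict_space space_pair_measure)
    ultimately show "{w \<in> space (restrict_space ?X {w. ?P w}). ?q w \<le> a} \<in> sets (restrict_space ?X {w. ?P w})"
      by simp
  qed
  then have g: "g \<in> partial_measurable ?X borel"
    unfolding g_def by (rule partial_measurable_If[OF P])
  have "K s = partial_distr uniform01 borel (\<lambda>u. g (s, u))" (is "_ = ?N") if s: "s \<in> space S" for s
  proof (rule cdf_unique'[OF fin[OF s]])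
    have gs: "(\<lambda>u. g (s, u)) \<in> partial_measurable uniform01 borel"
      by (rule measurable_compose[OF measurable_Pair1'[OF s] g])
    have "emeasure ?N UNIV \<le> emeasure uniform01 (space uniform01)"
      by (subst emeasure_partial_distr[OF gs]) (use emeasure_space[of uniform01] in auto)
    also have "\<dots> < \<infinity>"
      by (simp add: emeasure_restrict_space)
    finally show "finite_borel_measure ?N"
      by (auto simp: finite_borel_measure_def finite_borel_measure_axioms_def intro!: finite_measureI)
    show "cdf (K s) = cdf ?N"
    proof
      fix x
      let ?A = "{u \<in> space uniform01. g (s, u) \<in> Some ` {..x}}"
      \<comment> \<open>If \<open>F s x = m s\<close>, the right endpoint drops out because
        \<open>g\<close> is undefined there. Either interval has length
        \<open>F s x\<close>.\<close>
      have "?A = (if F s x < m s then {0<..F s x} else {0<..<m s})"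
        using quantile[OF s] F_bounds[OF s, of x] m_le_1[OF s]
        by (auto simp: g_def image_iff split: if_splits)
      moreover have "measure uniform01 ?A = measure lborel ?A"
        by (rule measure_restrict_space) auto
      ultimately have "measure uniform01 ?A = F s x"
        using F_bounds[OF s, of x] by auto
      then show "cdf (K s) x = cdf ?N x"
        by (simp add: F_def cdf_def[of ?N] measure_def emeasure_partial_distr[OF gs])
    qed
  qed
  with g show ?thesis by (rule that)
qed

text \<open>The kernel is pushed to the reals along \<open>f\<close>, randomized there, and brought
  back by \<open>p\<close>.\<close>

lemma standard_borel_kernel_randomization:
  fixes S :: "'s measure" and T :: "'t measure"
  assumes T: "standard_borel_space T"
    and K: "measure_kernel S T K"
    and le_1: "\<And>s. s \<in> space S \<Longrightarrow> emeasure (K s) (space T) \<le> 1"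
  obtains g where "g \<in> partial_measurable (S \<Otimes>\<^sub>M uniform01) T"
    "\<And>s. s \<in> space S \<Longrightarrow> K s = partial_distr uniform01 T (\<lambda>u. g (s, u))"
proof -
  obtain f :: "'t \<Rightarrow> real" and p where f: "f \<in> borel_measurable T"
    and p: "p \<in> partial_measurable borel T" and pf: "\<And>t. t \<in> space T \<Longrightarrow> p (f t) = Some t"
    using standard_borel_real_retract[OF T] by metis
  have sets_K: "sets (K s) = sets T" if "s \<in> space S" for s
    using K that by (auto simp: measure_kernel_def)
  have emeasure_L: "emeasure (distr (K s) borel f) B = emeasure (K s) (f -` B \<inter> space T)"
    if "s \<in> space S" "B \<in> sets borel" for s B
    using that f sets_eq_imp_space_eq[OF sets_K] by (subst emeasure_distr) (auto cong: measurable_cong_sets sets_K)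
  have "measure_kernel S borel (\<lambda>s. distr (K s) borel f)"
    unfolding measure_kernel_def
  proof (intro conjI ballI)
    fix B :: "real set" assume B: "B \<in> sets borel"
    have "(\<lambda>s. emeasure (K s) (f -` B \<inter> space T)) \<in> borel_measurable S"
      using K measurable_sets[OF f B] by (auto simp: measure_kernel_def)
    then show "(\<lambda>s. emeasure (distr (K s) borel f) B) \<in> borel_measurable S"
      by (rule measurable_cong[THEN iffD1, rotated]) (simp add: emeasure_L B)
  qed simp
  moreover have "emeasure (distr (K s) borel f) UNIV \<le> 1" if "s \<in> space S" for s
    using le_1[OF that] by (simp add: emeasure_L that)
  ultimately obtain g where g: "g \<in> partial_measurable (S \<Otimes>\<^sub>M uniform01) borel"
    and L: "\<And>s. s \<in> space S \<Longrightarrow> distr (K s) borel f = partial_distr uniform01 borel (\<lambda>u. g (s, u))"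
    by (rule real_kernel_randomization) blast+
  let ?h = "\<lambda>w. Option.bind (g w) p"
  have h: "?h \<in> partial_measurable (S \<Otimes>\<^sub>M uniform01) T"
    by (rule measurable_compose[OF g measurable_bind_partial[OF p]])
  have "K s = partial_distr uniform01 T (\<lambda>u. ?h (s, u))" if s: "s \<in> space S" for s
  proof (rule measure_eqI)
    show "sets (K s) = sets (partial_distr uniform01 T (\<lambda>u. ?h (s, u)))"
      by (simp add: sets_K[OF s])
  next
    fix B assume "B \<in> sets (K s)"
    then have B: "B \<in> sets T"
      by (simp add: sets_K[OF s])
    have pB: "{x. p x \<in> Some ` B} \<in> sets borel"
      using partial_measurable_vimage[OF p B] by simp
    have gs: "(\<lambda>u. g (s, u)) \<in> partial_measurable uniform01 borel"
      and hs: "(\<lambda>u. ?h (s, u)) \<in> partial_measurable uniform01 T"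
      by (rule measurable_compose[OF measurable_Pair1'[OF s] g] measurable_compose[OF measurable_Pair1'[OF s] h])+
    \<comment> \<open>As \<open>p\<close> undoes \<open>f\<close> on \<open>T\<close>, every
      measurable \<open>B\<close> is the preimage under \<open>f\<close> of a Borel set, so the
      push-forward to the reals loses no information.\<close>
    have "B = f -` {x. p x \<in> Some ` B} \<inter> space T"
      using pf sets.sets_into_space[OF B] by auto
    then have "emeasure (K s) B = emeasure (distr (K s) borel f) {x. p x \<in> Some ` B}"
      by (simp add: emeasure_L[OF s pB])
    also have "\<dots> = emeasure uniform01 {u \<in> space uniform01. g (s, u) \<in> Some ` {x. p x \<in> Some ` B}}"
      unfolding L[OF s] by (rule emeasure_partial_distr[OF gs pB])
    also have "{u \<in> space uniform01. g (s, u) \<in> Some ` {x. p x \<in> Some ` B}} =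
        {u \<in> space uniform01. ?h (s, u) \<in> Some ` B}"
      by (auto simp: bind_eq_Some_conv)
    also have "emeasure uniform01 \<dots> = emeasure (partial_distr uniform01 T (\<lambda>u. ?h (s, u))) B"
      by (rule emeasure_partial_distr[OF hs B, symmetric])
    finally show "emeasure (K s) B = emeasure (partial_distr uniform01 T (\<lambda>u. ?h (s, u))) B" .
  qed
  with h show ?thesis by (rule that)
qed

section \<open>From subprobability kernels to finite kernels\<close>

text \<open>A uniform bound \<open>N\<close> on the masses is divided out. It is taken to be a
  natural number so that multiplying by \<open>N\<close> can later be realized as \<open>N\<close>
  repeated copies.\<close>

lemma finite_kernel_randomization:
  fixes S :: "'s measure" and T :: "'t measure"
  assumes T: "standard_borel_space T" and K: "finite_kernel S T K"
  obtains g and N :: nat where "g \<in> partial_measurable (S \<Otimes>\<^sub>M uniform01) T"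
    "\<And>s B. s \<in> space S \<Longrightarrow> B \<in> sets T \<Longrightarrow>
      emeasure (K s) B = of_nat N * emeasure (partial_distr uniform01 T (\<lambda>u. g (s, u))) B"
proof -
  have mK: "measure_kernel S T K" and fin: "(SUP s\<in>space S. emeasure (K s) (space T)) < \<infinity>"
    using K by (auto simp: finite_kernel_def)
  obtain N0 :: nat where N0: "(SUP s\<in>space S. emeasure (K s) (space T)) < of_nat N0"
    using fin ennreal_Ex_less_of_nat by auto
  \<comment> \<open>The successor makes \<open>N\<close> visibly nonzero, for the cancellation
    below.\<close>
  define N where "N = Suc N0"
  have le_N: "emeasure (K s) (space T) \<le> of_nat N" if "s \<in> space S" for s
  proof -
    have "emeasure (K s) (space T) \<le> (SUP s\<in>space S. emeasure (K s) (space T))"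
      using that by (rule SUP_upper)
    also have "\<dots> \<le> of_nat N0"
      using N0 by simp
    also have "\<dots> \<le> of_nat N"
      by (simp add: N_def)
    finally show ?thesis .
  qed
  have cancel: "of_nat N * (inverse (of_nat N) * a) = a" for a :: ennreal
  proof -
    have "of_nat N \<noteq> (0 :: ennreal)"
      by (simp add: N_def)
    from mult_divide_eq_ennreal[OF this, of a] show ?thesis
      by (simp add: divide_ennreal_def ac_simps)
  qed
  let ?L = "\<lambda>s. scale_measure (inverse (of_nat N)) (K s)"
  have "measure_kernel S T ?L"
    using mK by (auto simp: measure_kernel_def)
  moreover have "emeasure (?L s) (space T) \<le> 1" if "s \<in> space S" for s
  proof -
    have "emeasure (?L s) (space T) \<le> inverse (of_nat N) * of_nat N"
      using le_N[OF that] by (simp add: mult_left_mono)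
    also have "\<dots> = 1"
      using cancel[of 1] by (simp add: mult.commute)
    finally show ?thesis .
  qed
  ultimately obtain g where g: "g \<in> partial_measurable (S \<Otimes>\<^sub>M uniform01) T"
    and L: "\<And>s. s \<in> space S \<Longrightarrow> ?L s = partial_distr uniform01 T (\<lambda>u. g (s, u))"
    by (rule standard_borel_kernel_randomization[OF T]) blast+
  show ?thesis
    by (rule that[OF g, of N]) (simp add: L[symmetric] cancel)
qed

section \<open>Slices at a natural number, and s-finite kernels\<close>

lemma partial_measurable_slice:
  assumes d: "d \<in> partial_measurable (S \<Otimes>\<^sub>M (counting_nat \<Otimes>\<^sub>M uniform01)) T"
  shows "(\<lambda>w. d (fst w, n, snd w)) \<in> partial_measurable (S \<Otimes>\<^sub>M uniform01) T"
  by (rule measurable_compose[OF _ d]) measurable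

text \<open>The product measure of a set integrates the measures of its sections, and an integral
  against counting measure is a series. Both directions of the theorem rest on this.\<close>

lemma emeasure_partial_distr_slices:
  assumes d: "d \<in> partial_measurable (S \<Otimes>\<^sub>M (counting_nat \<Otimes>\<^sub>M uniform01)) T"
    and s: "s \<in> space S" and B: "B \<in> sets T"
  shows "emeasure (partial_distr (counting_nat \<Otimes>\<^sub>M uniform01) T (\<lambda>x. d (s, x))) B =
    (\<Sum>n. emeasure (partial_distr uniform01 T (\<lambda>u. d (s, n, u))) B)"
proof -
  interpret sigma_finite_measure uniform01 by (rule sigma_finite_uniform01)
  have ds: "(\<lambda>x. d (s, x)) \<in> partial_measurable (counting_nat \<Otimes>\<^sub>M uniform01) T"
    by (rule measurable_compose[OF measurable_Pair1'[OF s] d])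
  have dsn: "(\<lambda>u. d (s, n, u)) \<in> partial_measurable uniform01 T" for n
    by (rule measurable_compose[OF measurable_Pair1' ds]) simp
  let ?A = "{x \<in> space (counting_nat \<Otimes>\<^sub>M uniform01). d (s, x) \<in> Some ` B}"
  have "emeasure (partial_distr (counting_nat \<Otimes>\<^sub>M uniform01) T (\<lambda>x. d (s, x))) B =
      emeasure (counting_nat \<Otimes>\<^sub>M uniform01) ?A"
    by (rule emeasure_partial_distr[OF ds B])
  also have "\<dots> = (\<Sum>n. emeasure uniform01 ((\<lambda>n. Pair n -` ?A) n))"
    by (simp only: emeasure_pair_measure_alt[OF partial_measurable_vimage[OF ds B]] nn_integral_count_space_nat)
  also have "(\<lambda>n. Pair n -` ?A) = (\<lambda>n. {u \<in> space uniform01. d (s, n, u) \<in> Some ` B})"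
    by (auto simp: space_pair_measure)
  finally show ?thesis
    by (simp only: emeasure_partial_distr[OF dsn B])
qed

text \<open>The masses are bounded by 1, the mass of the uniform measure; measurability in
  \<open>s\<close> is that of the measure of a section of a measurable set.\<close>

lemma finite_kernel_partial_distr_uniform01:
  assumes d: "d \<in> partial_measurable (S \<Otimes>\<^sub>M uniform01) T"
  shows "finite_kernel S T (\<lambda>s. partial_distr uniform01 T (\<lambda>u. d (s, u)))"
proof -
  interpret sigma_finite_measure uniform01 by (rule sigma_finite_uniform01)
  have ds: "(\<lambda>u. d (s, u)) \<in> partial_measurable uniform01 T" if "s \<in> space S" for s
    by (rule measurable_compose[OF measurable_Pair1'[OF that] d])
  have "(\<lambda>s. emeasure (partial_distr uniform01 T (\<lambda>u. d (s, u))) B) \<in> borel_measurable S"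
    if B: "B \<in> sets T" for B
  proof -
    let ?A = "{w \<in> space (S \<Otimes>\<^sub>M uniform01). d w \<in> Some ` B}"
    have "(\<lambda>s. emeasure uniform01 (Pair s -` ?A)) \<in> borel_measurable S"
      by (rule measurable_emeasure_Pair[OF partial_measurable_vimage[OF d B]])
    moreover have "emeasure uniform01 (Pair s -` ?A) = emeasure (partial_distr uniform01 T (\<lambda>u. d (s, u))) B"
      if "s \<in> space S" for s
      unfolding emeasure_partial_distr[OF ds[OF that] B]
      by (rule arg_cong[of _ _ "emeasure uniform01"]) (use that in \<open>auto simp: space_pair_measure\<close>)
    ultimately show ?thesis
      by (rule measurable_cong[THEN iffD1, rotated])
  qed
  moreover have "(SUP s\<in>space S. emeasure (partial_distr uniform01 T (\<lambda>u. d (s, u))) (space T)) \<le> 1"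
  proof (rule SUP_least)
    fix s assume "s \<in> space S"
    from ds[OF this] have "emeasure (partial_distr uniform01 T (\<lambda>u. d (s, u))) (space T) \<le>
        emeasure uniform01 (space uniform01)"
      by (subst emeasure_partial_distr) (use emeasure_space[of uniform01] in auto)
    then show "emeasure (partial_distr uniform01 T (\<lambda>u. d (s, u))) (space T) \<le> 1"
      by (simp add: emeasure_restrict_space)
  qed
  then have "(SUP s\<in>space S. emeasure (partial_distr uniform01 T (\<lambda>u. d (s, u))) (space T)) < \<infinity>"
    by (rule le_less_trans) simp
  ultimately show ?thesis
    by (simp add: finite_kernel_def measure_kernel_def)
qed

lemma s_finite_kernel_randomization:
  fixes S :: "'s measure" and T :: "'t measure"
  assumes T: "standard_borel_space T" and \<sigma>: "s_finite_kernel S T \<sigma>"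
  obtains d where "d \<in> partial_measurable (S \<Otimes>\<^sub>M (counting_nat \<Otimes>\<^sub>M uniform01)) T"
    "\<And>s. s \<in> space S \<Longrightarrow> \<sigma> s = partial_distr (counting_nat \<Otimes>\<^sub>M uniform01) T (\<lambda>x. d (s, x))"
proof -
  obtain \<tau> :: "nat \<Rightarrow> 's \<Rightarrow> 't measure" where \<tau>: "\<And>i. finite_kernel S T (\<tau> i)"
    and sum: "\<And>s B. s \<in> space S \<Longrightarrow> B \<in> sets T \<Longrightarrow> emeasure (\<sigma> s) B = (\<Sum>i. emeasure (\<tau> i s) B)"
    and sets_\<sigma>: "\<And>s. s \<in> space S \<Longrightarrow> sets (\<sigma> s) = sets T"
    using \<sigma> unfolding s_finite_kernel_def measure_kernel_def by blast
  have "\<exists>g N. g \<in> partial_measurable (S \<Otimes>\<^sub>M uniform01) T \<and> (\<forall>s\<in>space S. \<forall>B\<in>sets T.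
      emeasure (\<tau> i s) B = of_nat N * emeasure (partial_distr uniform01 T (\<lambda>u. g (s, u))) B)" for i
    using finite_kernel_randomization[OF T \<tau>[of i]] by metis
  then obtain g and N :: "nat \<Rightarrow> nat" where g: "\<And>i. g i \<in> partial_measurable (S \<Otimes>\<^sub>M uniform01) T"
    and \<tau>_eq: "\<And>i s B. s \<in> space S \<Longrightarrow> B \<in> sets T \<Longrightarrow>
      emeasure (\<tau> i s) B = of_nat (N i) * emeasure (partial_distr uniform01 T (\<lambda>u. g i (s, u))) B"
    by metis
  \<comment> \<open>Index \<open>(i, j)\<close> with \<open>j < N i\<close> carries the \<open>j\<close>-th of the \<open>N i\<close> equal subprobability summands of \<open>\<tau> i\<close>.\<close>
  define e where "e = (\<lambda>(i, j) w. if j < N i then g i w else None)"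
  define d where "d = (\<lambda>(s, n, u). e (prod_decode n) (s, u))"
  have e: "e ij \<in> partial_measurable (S \<Otimes>\<^sub>M uniform01) T" for ij
    using g by (cases ij) (auto simp: e_def)
  have "(\<lambda>x. e (prod_decode (fst (snd x))) (fst x, snd (snd x))) \<in>
      partial_measurable (S \<Otimes>\<^sub>M (counting_nat \<Otimes>\<^sub>M uniform01)) T"
  \<comment> \<open>The natural-number component takes countably many values, so each value can be
    treated separately.\<close>
  proof (rule measurable_compose_countable'[where g = "\<lambda>x. fst (snd x)" and I = UNIV])
    show "(\<lambda>x. e (prod_decode n) (fst x, snd (snd x))) \<in>
        partial_measurable (S \<Otimes>\<^sub>M (counting_nat \<Otimes>\<^sub>M uniform01)) T" for n
      by (rule measurable_compose[OF _ e]) measurable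
  qed auto
  then have d: "d \<in> partial_measurable (S \<Otimes>\<^sub>M (counting_nat \<Otimes>\<^sub>M uniform01)) T"
    by (simp add: d_def case_prod_beta')
  have "\<sigma> s = partial_distr (counting_nat \<Otimes>\<^sub>M uniform01) T (\<lambda>x. d (s, x))" if s: "s \<in> space S" for s
  proof (rule measure_eqI)
    fix B assume "B \<in> sets (\<sigma> s)"
    then have B: "B \<in> sets T"
      by (simp add: sets_\<sigma>[OF s])
    \<comment> \<open>Row \<open>i\<close> of this double series has \<open>N i\<close> equal
      entries followed by zeros and sums to \<open>\<tau> i\<close>. In \<open>ennreal\<close> the
      rows may then be summed along \<open>prod_decode\<close>.\<close>
    define E where "E ij = emeasure (partial_distr uniform01 T (\<lambda>u. e ij (s, u))) B" for ij
    have E: "E (i, j) = (if j < N i then emeasure (partial_distr uniform01 T (\<lambda>u. g i (s, u))) B else 0)" for i j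
      using B by (simp add: E_def e_def emeasure_partial_distr image_iff)
    have "(\<Sum>j. E (i, j)) = emeasure (\<tau> i s) B" for i
    proof -
      have "(\<Sum>j. E (i, j)) = (\<Sum>j<N i. E (i, j))"
        by (rule suminf_finite) (auto simp: E)
      then show ?thesis
        using \<tau>_eq[OF s B] by (simp add: E)
    qed
    then have "(\<Sum>n. E (prod_decode n)) = (\<Sum>i. emeasure (\<tau> i s) B)"
      by (intro suminf_ennreal_2dimen) simp
    then show "emeasure (\<sigma> s) B = emeasure (partial_distr (counting_nat \<Otimes>\<^sub>M uniform01) T (\<lambda>x. d (s, x))) B"
      unfolding emeasure_partial_distr_slices[OF d s B] sum[OF s B] by (simp add: E_def d_def)
  qed (simp add: sets_\<sigma>[OF s])
  with d show ?thesis by (rule that)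
qed

text \<open>The slices of \<open>d\<close> serve as the finite summands, and
  \<open>emeasure_partial_distr_slices\<close> adds them up to \<open>\<sigma>\<close>.\<close>

lemma s_finite_kernel_partial_distr:
  assumes K: "measure_kernel S T \<sigma>"
    and d: "d \<in> partial_measurable (S \<Otimes>\<^sub>M (counting_nat \<Otimes>\<^sub>M uniform01)) T"
    and eq: "\<And>s. s \<in> space S \<Longrightarrow> \<sigma> s = partial_distr (counting_nat \<Otimes>\<^sub>M uniform01) T (\<lambda>x. d (s, x))"
  shows "s_finite_kernel S T \<sigma>"
  unfolding s_finite_kernel_def
proof (intro conjI K exI[of _ "\<lambda>n s. partial_distr uniform01 T (\<lambda>u. d (s, n, u))"] allI ballI)
  show "finite_kernel S T (\<lambda>s. partial_distr uniform01 T (\<lambda>u. d (s, n, u)))" for n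
    using finite_kernel_partial_distr_uniform01[OF partial_measurable_slice[OF d]] by simp
qed (simp add: eq emeasure_partial_distr_slices[OF d])

theorem theorem14:
  fixes S :: "'s measure" and T :: "'t measure" and \<sigma> :: "'s \<Rightarrow> 't measure"
  assumes "standard_borel_space T"
  shows "(s_finite_kernel S T \<sigma> \<longrightarrow>
            (\<exists>d \<in> partial_measurable (S \<Otimes>\<^sub>M (counting_nat \<Otimes>\<^sub>M uniform01)) T.
               \<forall>s\<in>space S. \<sigma> s = partial_distr (counting_nat \<Otimes>\<^sub>M uniform01) T (\<lambda>x. d (s, x))))
       \<and> (measure_kernel S T \<sigma> \<longrightarrow>
            (\<forall>d \<in> partial_measurable (S \<Otimes>\<^sub>M (counting_nat \<Otimes>\<^sub>M uniform01)) T.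
               (\<forall>s\<in>space S. \<sigma> s = partial_distr (counting_nat \<Otimes>\<^sub>M uniform01) T (\<lambda>x. d (s, x)))
               \<longrightarrow> s_finite_kernel S T \<sigma>))"
proof (intro conjI impI ballI)
  assume "s_finite_kernel S T \<sigma>"
  from s_finite_kernel_randomization[OF assms this]
  show "\<exists>d \<in> partial_measurable (S \<Otimes>\<^sub>M (counting_nat \<Otimes>\<^sub>M uniform01)) T.
      \<forall>s\<in>space S. \<sigma> s = partial_distr (counting_nat \<Otimes>\<^sub>M uniform01) T (\<lambda>x. d (s, x))"
    by metis
qed (rule s_finite_kernel_partial_distr, auto)

end
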